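(* Let $A,B,C,D,E\in\mathbb{C}^{n\times n}$. In floating point arithmetic (as modelled in the context), let $E\widetilde{\Pi}_E\approx\widetilde{Q}_E\begin{pmatrix}\widetilde{R}_E\\ \mathbf{0}\end{pmatrix}$ be the computed rank revealing QR factorization of $E$, with truncation threshold $\tau$, let $\widetilde{r}_E=k$ be the computed numerical rank of $E$ (so $\widetilde{R}_E$ is $k\times n$), and let $\widetilde{X}=computed(\widetilde{Q}_E^*D)$, $\widetilde{Y}=computed(\widetilde{Q}_E^*C)$. Let $$\widetilde{\mathbb{A}}_{22}=\begin{pmatrix} B&\mathbf{0}&-\mathbb{I}_n&\mathbf{0}\\ \widetilde{X}&\mathbf{0}&\mathbf{0}&\begin{pmatrix}-\mathbb{I}_{\widetilde{r}_E}\\ \mathbf{0}\end{pmatrix}\\ \mathbf{0}&-\mathbb{I}_n&\mathbf{0}&\mathbf{0}\\ \widetilde{R}_E\widetilde{\Pi}_E^T&\mathbf{0}&\mathbf{0}&\mathbf{0}\end{pmatrix},\qquad \widetilde{\mathbb{B}}_{22}=\begin{pmatrix}-A&\mathbf{0}&\mathbf{0}&\mathbf{0}\\ -\widetilde{Y}&-\widetilde{Q}_E^*&\mathbf{0}&\mathbf{0}\\ \mathbf{0}&\mathbf{0}&-\mathbb{I}_n&\mathbf{0}\\ \mathbf{0}&\mathbf{0}&\mathbf{0}&-\mathbb{I}_{\widetilde{r}_E}\end{pmatrix}$$ (block rows and block columns of sizes $n,n,n,\widetilde{r}_E$) be the computed reduced pencil $\widetilde{\mathbb{A}}_{22}-\lambda\widetilde{\mathbb{B}}_{22}$.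 Then there exists a structured perturbation, with the same block partition, $$\delta\widetilde{\mathbb{B}}_{22}=\begin{pmatrix}\mathbf{0}&\mathbf{0}&\mathbf{0}&\mathbf{0}\\ \mathbf{0}&-\delta Q_E^*&\mathbf{0}&\mathbf{0}\\ \mathbf{0}&\mathbf{0}&\mathbf{0}&\mathbf{0}\\ \mathbf{0}&\mathbf{0}&\mathbf{0}&\mathbf{0}\end{pmatrix},\qquad \|\delta Q_E\|_F\le\epsilon_{qr},$$ and there exist $\delta C,\delta D,\delta E,\Delta E\in\mathbb{C}^{n\times n}$ such that $\widetilde{\mathbb{A}}_{22}-\lambda(\widetilde{\mathbb{B}}_{22}+\delta\widetilde{\mathbb{B}}_{22})$ is an exact reduced linearization (as defined in the context) of the quartic matrix polynomial $$\lambda^4A+\lambda^3B+\lambda^2(C+\delta C)+\lambda(D+\delta D)+(E+\delta E+\Delta E),$$ which has at least $n-\widetilde{r}_E$ zero eigenvalues, where for all $i=1,\ldots,n$ $$\|\delta C(:,i)\|_2\le\epsilon_C\|C(:,i)\|_2,\quad \|\delta D(:,i)\|_2\le\epsilon_D\|D(:,i)\|_2,\quad \|\delta E(:,i)\|_2\le\epsilon_{qr}\|E(:,i)\|_2,$$ and the truncation error $\Delta E$ from the determination of the numerical rank of $E$ satisfies $$\max_{j=1:n-k}\|(\Delta E)\widetilde{\Pi}_E(:,k+j)\|_2\le\tau\min_{i=1:k}\|(E+\delta E)\widetilde{\Pi}_E(:,i)\|_2,\qquad (\Delta E)\widetilde{\Pi}_E(:,1:k)=\mathbf{0}_{n,k}.$$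 Here $\epsilon_C,\epsilon_D,\epsilon_{qr}$ are bounded by a moderate function of $n$ times the machine precision $\boldsymbol{\varepsilon}$.
   Context: Notation. $\mathbb{I}_m$ is the $m\times m$ identity, $\mathbf{0}$ a zero block, $M(:,i)$ the $i$-th column of $M$, $|M|$ the entrywise absolute value, inequalities between matrices are entrywise. $(\Delta E)\widetilde{\Pi}_E(:,j)$ denotes the $j$-th column of the product $(\Delta E)\widetilde{\Pi}_E$ (similarly for $(E+\delta E)\widetilde{\Pi}_E$). A maximum over an empty index set is $0$. $\boldsymbol{\varepsilon}$ is the machine precision, and $n\boldsymbol{\varepsilon}$ is assumed sufficiently small for the standard error bounds below. "Moderate function of $n$" means a fixed low-degree polynomial in $n$, independent of the data. Linearization. For coefficients $A,B,C,D,E$, the quartic polynomial $\lambda^4A+\lambda^3B+\lambda^2C+\lambda D+E$ is linearized by the $4n\times4n$ pencil $$\mathbb{A}-\lambda\mathbb{B}=\begin{pmatrix}B&\mathbf{0}&-\mathbb{I}_n&\mathbf{0}\\ D&\mathbf{0}&\mathbf{0}&-\mathbb{I}_n\\ \mathbf{0}&-\mathbb{I}_n&\mathbf{0}&\mathbf{0}\\ E&\mathbf{0}&\mathbf{0}&\mathbf{0}\end{pmatrix}-\lambda\begin{pmatrix}-A&\mathbf{0}&\mathbf{0}&\mathbf{0}\\ -C&-\mathbb{I}_n&\mathbf{0}&\mathbf{0}\\ \mathbf{0}&\mathbf{0}&-\mathbb{I}_n&\mathbf{0}\\ \mathbf{0}&\mathbf{0}&\mathbf{0}&-\mathbb{I}_n\end{pmatrix}.$$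 Exact reduced linearization. A pencil of order $3n+r$ is an exact reduced linearization of a quartic polynomial with linearization $\mathbb{A}-\lambda\mathbb{B}$ if there is an exactly unitary $n\times n$ matrix $Q$ such that $$(\mathbb{I}_n\oplus Q^*\oplus\mathbb{I}_n\oplus Q^* )(\mathbb{A}-\lambda\mathbb{B})(\mathbb{I}_n\oplus\mathbb{I}_n\oplus\mathbb{I}_n\oplus Q)$$ is block upper triangular with the given pencil as its leading $(3n+r)\times(3n+r)$ diagonal block and with trailing diagonal block $\mathbf{0}-\lambda(-\mathbb{I}_{n-r})$ (this trailing block carries $n-r$ deflated zero eigenvalues). "At least $m$ zero eigenvalues" means that $\lambda^m$ divides the determinant of the matrix polynomial. Computed rank revealing QR factorization of $E$. This is the Householder QR factorization with Businger–Golub column pivoting, executed in floating point, followed by truncation. As is standard, there are an exactly unitary $\widehat{Q}_E$, a permutation matrix $\widetilde{\Pi}_E$ and a matrix $\delta E$ with $$(E+\delta E)\widetilde{\Pi}_E=\widehat{Q}_ER,\qquad \|\delta E(:,i)\|_2\le\epsilon_{qr}\|E(:,i)\|_2\ \ (i=1,\ldots,n),\qquad \|\widetilde{Q}_E-\widehat{Q}_E\|_F\le\epsilon_{qr},$$ where $\widetilde{Q}_E$ is the computed (numerically unitary) factor, $R$ is the computed upper triangular factor, whose pivoting structure is $|R_{ii}|\ge\big(\sum_{l=i}^{j}|R_{lj}|^2\big)^{1/2}$ for $i\le j$, and $\epsilon_{qr}$ is a moderate function of $n$ times $\boldsymbol{\varepsilon}$. The numerical rank $\widetilde{r}_E=k$,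 $1\le k\le n$, is determined with a prescribed threshold $\tau$ by a drop-off: $|R_{k+1,k+1}|\le\tau|R_{kk}|$ (no condition if $k=n$). Then the trailing $(n-k)\times(n-k)$ block of $R$ is set to zero, and $\widetilde{R}_E=R(1:k,:)$. Computed products. $computed(\widetilde{Q}_E^*D)=\widetilde{Q}_E^*D+\delta_0D$ with $|\delta_0D|\le\epsilon|\widetilde{Q}_E^*||D|$, $0\le\epsilon\le O(n)\boldsymbol{\varepsilon}$, and likewise for $computed(\widetilde{Q}_E^*C)$. *)

theory Defs
  imports "Jordan_Normal_Form.Schur_Decomposition"
begin

text \<open>Matrices have varying, explicitly given sizes; indices are 0-based, so index \<open>i\<close>
  of the usual 1-based notation is \<open>i - 1\<close> here.\<close>

definition vec_norm2 :: "complex vec \<Rightarrow> real" where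
  "vec_norm2 v = sqrt (\<Sum>i<dim_vec v. (cmod (v $ i))\<^sup>2)"

definition frobenius_norm :: "complex mat \<Rightarrow> real" where
  "frobenius_norm M = sqrt (\<Sum>i<dim_row M. \<Sum>j<dim_col M. (cmod (M $$ (i,j)))\<^sup>2)"

definition abs_mat :: "complex mat \<Rightarrow> real mat" where
  "abs_mat M = map_mat cmod M"

definition mat_entrywise_le :: "real mat \<Rightarrow> real mat \<Rightarrow> bool" where
  "mat_entrywise_le M N \<longleftrightarrow> dim_row M = dim_row N \<and> dim_col M = dim_col N \<and>
     (\<forall>i<dim_row M. \<forall>j<dim_col M. M $$ (i,j) \<le> N $$ (i,j))"

definition unitary_mat :: "nat \<Rightarrow> complex mat \<Rightarrow> bool" where
  "unitary_mat n Q \<longleftrightarrow> Q \<in> carrier_mat n n \<and>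
     mat_adjoint Q * Q = 1\<^sub>m n \<and> Q * mat_adjoint Q = 1\<^sub>m n"

definition permutation_mat :: "nat \<Rightarrow> complex mat \<Rightarrow> bool" where
  "permutation_mat n P \<longleftrightarrow>
     (\<exists>p. p permutes {..<n} \<and> P = mat n n (\<lambda>(i,j). if i = p j then 1 else 0))"

definition max_or_zero :: "real set \<Rightarrow> real" where
  "max_or_zero S = (if S = {} then 0 else Max S)"

text \<open>The arguments are the blocks, row by row; the block sizes are those of the blocks.\<close>

definition block_mat_4x4 ::
  "'a mat \<Rightarrow> 'a mat \<Rightarrow> 'a mat \<Rightarrow> 'a mat \<Rightarrow> 'a mat \<Rightarrow> 'a mat \<Rightarrow> 'a mat \<Rightarrow> 'a mat \<Rightarrow>
   'a mat \<Rightarrow> 'a mat \<Rightarrow> 'a mat \<Rightarrow> 'a mat \<Rightarrow> 'a mat \<Rightarrow> 'a mat \<Rightarrow> 'a mat \<Rightarrow> 'a mat \<Rightarrow> 'a mat" where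
  "block_mat_4x4 M11 M12 M13 M14
                 M21 M22 M23 M24
                 M31 M32 M33 M34
                 M41 M42 M43 M44 =
     four_block_mat (four_block_mat M11 M12 M21 M22) (four_block_mat M13 M14 M23 M24)
                    (four_block_mat M31 M32 M41 M42) (four_block_mat M33 M34 M43 M44)"


text \<open>Matrix polynomials are matrices over \<^typ>\<open>complex poly\<close>; the variable \<open>\<lambda>\<close> is
  \<^term>\<open>monom 1 1 :: complex poly\<close>.\<close>

definition const_mat :: "complex mat \<Rightarrow> complex poly mat" where
  "const_mat M = map_mat (\<lambda>a. [:a:]) M"

definition pencil :: "complex mat \<Rightarrow> complex mat \<Rightarrow> complex poly mat" where
  "pencil M N = const_mat M - monom 1 1 \<cdot>\<^sub>m const_mat N"

definition quartic ::
  "complex mat \<Rightarrow> complex mat \<Rightarrow> complex mat \<Rightarrow> complex mat \<Rightarrow> complex mat \<Rightarrow> complex poly mat" where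
  "quartic A B C D E =
     monom 1 4 \<cdot>\<^sub>m const_mat A + monom 1 3 \<cdot>\<^sub>m const_mat B + monom 1 2 \<cdot>\<^sub>m const_mat C
     + monom 1 1 \<cdot>\<^sub>m const_mat D + const_mat E"

definition zero_eigenvalues_at_least :: "nat \<Rightarrow> complex poly mat \<Rightarrow> bool" where
  "zero_eigenvalues_at_least m P \<longleftrightarrow> monom 1 m dvd det P"

definition linearization_A :: "nat \<Rightarrow> complex mat \<Rightarrow> complex mat \<Rightarrow> complex mat \<Rightarrow> complex mat" where
  "linearization_A n B D E = block_mat_4x4
     B           (0\<^sub>m n n)    (- 1\<^sub>m n)    (0\<^sub>m n n)
     D           (0\<^sub>m n n)    (0\<^sub>m n n)    (- 1\<^sub>m n)
     (0\<^sub>m n n)   (- 1\<^sub>m n)    (0\<^sub>m n n)    (0\<^sub>m n n)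
     E           (0\<^sub>m n n)    (0\<^sub>m n n)    (0\<^sub>m n n)"

definition linearization_B :: "nat \<Rightarrow> complex mat \<Rightarrow> complex mat \<Rightarrow> complex mat" where
  "linearization_B n A C = block_mat_4x4
     (- A)       (0\<^sub>m n n)    (0\<^sub>m n n)    (0\<^sub>m n n)
     (- C)       (- 1\<^sub>m n)    (0\<^sub>m n n)    (0\<^sub>m n n)
     (0\<^sub>m n n)   (0\<^sub>m n n)    (- 1\<^sub>m n)    (0\<^sub>m n n)
     (0\<^sub>m n n)   (0\<^sub>m n n)    (0\<^sub>m n n)    (- 1\<^sub>m n)"

text \<open>\<open>M - \<lambda> N\<close> is an exact reduced linearization, of order \<open>3 n + r\<close>, of the quartic polynomial
  with coefficients \<open>A\<close>, \<open>B\<close>, \<open>C\<close>, \<open>D\<close>, \<open>E\<close>. The block \<open>U\<close> above the deflated part is arbitrary.\<close>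

definition exact_reduced_linearization ::
  "nat \<Rightarrow> nat \<Rightarrow> complex mat \<Rightarrow> complex mat \<Rightarrow>
   complex mat \<Rightarrow> complex mat \<Rightarrow> complex mat \<Rightarrow> complex mat \<Rightarrow> complex mat \<Rightarrow> bool" where
  "exact_reduced_linearization n r M N A B C D E \<longleftrightarrow>
     r \<le> n \<and>
     M \<in> carrier_mat (3 * n + r) (3 * n + r) \<and> N \<in> carrier_mat (3 * n + r) (3 * n + r) \<and>
     (\<exists>Q U. unitary_mat n Q \<and> U \<in> carrier_mat (3 * n + r) (n - r) \<and>
        const_mat (diag_block_mat [1\<^sub>m n, mat_adjoint Q, 1\<^sub>m n, mat_adjoint Q])
          * pencil (linearization_A n B D E) (linearization_B n A C)
          * const_mat (diag_block_mat [1\<^sub>m n, 1\<^sub>m n, 1\<^sub>m n, Q])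
        = four_block_mat (pencil M N) U
            (0\<^sub>m (n - r) (3 * n + r)) (pencil (0\<^sub>m (n - r) (n - r)) (- 1\<^sub>m (n - r))))"


text \<open>Standard model of the Householder QR factorization with Businger--Golub pivoting in
  floating point arithmetic: \<open>Qt\<close> is the computed (numerically unitary) factor, \<open>P\<close> the
  permutation matrix, \<open>R\<close> the computed upper triangular factor before truncation, and \<open>k\<close> the
  numerical rank found with threshold \<open>\<tau>\<close>. The exactly unitary \<open>Qh\<close> and the backward error \<open>dE\<close>
  are those of the standard error analysis.\<close>

definition computed_rrqr ::
  "nat \<Rightarrow> real \<Rightarrow> real \<Rightarrow> complex mat \<Rightarrow> complex mat \<Rightarrow> complex mat \<Rightarrow> complex mat \<Rightarrow> nat \<Rightarrow> bool" where
  "computed_rrqr n \<epsilon>\<^sub>q\<^sub>r \<tau> E Qt P R k \<longleftrightarrow>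
     Qt \<in> carrier_mat n n \<and> permutation_mat n P \<and>
     R \<in> carrier_mat n n \<and> upper_triangular R \<and>
     (\<exists>Qh dE. unitary_mat n Qh \<and> dE \<in> carrier_mat n n \<and>
        (E + dE) * P = Qh * R \<and>
        (\<forall>i<n. vec_norm2 (col dE i) \<le> \<epsilon>\<^sub>q\<^sub>r * vec_norm2 (col E i)) \<and>
        frobenius_norm (Qt - Qh) \<le> \<epsilon>\<^sub>q\<^sub>r) \<and>
     (\<forall>j<n. \<forall>i\<le>j. sqrt (\<Sum>l=i..j. (cmod (R $$ (l,j)))\<^sup>2) \<le> cmod (R $$ (i,i))) \<and>
     1 \<le> k \<and> k \<le> n \<and>
     (k < n \<longrightarrow> cmod (R $$ (k,k)) \<le> \<tau> * cmod (R $$ (k - 1, k - 1)))"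

text \<open>The first \<open>k\<close> rows, i.e. the nonzero part of \<open>R\<close> after its trailing block is set to zero.\<close>

definition truncated_R :: "nat \<Rightarrow> complex mat \<Rightarrow> complex mat" where
  "truncated_R k R = mat k (dim_col R) (\<lambda>(i,j). R $$ (i,j))"

text \<open>\<open>X\<close> is a possible computed value of the product of the adjoint of \<open>Q\<close> with \<open>M\<close>, where
  the \<open>O(n)\<close> factor of the error bound is \<open>c n\<close> and \<open>u\<close> is the machine precision.\<close>

definition computed_adjoint_product ::
  "nat \<Rightarrow> real \<Rightarrow> real \<Rightarrow> complex mat \<Rightarrow> complex mat \<Rightarrow> complex mat \<Rightarrow> bool" where
  "computed_adjoint_product n c u Q M X \<longleftrightarrow>
     (\<exists>\<epsilon> d0. 0 \<le> \<epsilon> \<and> \<epsilon> \<le> c * real n * u \<and> d0 \<in> carrier_mat n n \<and>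
        mat_entrywise_le (abs_mat d0) (\<epsilon> \<cdot>\<^sub>m (abs_mat (mat_adjoint Q) * abs_mat M)) \<and>
        X = mat_adjoint Q * M + d0)"

definition reduced_A ::
  "nat \<Rightarrow> nat \<Rightarrow> complex mat \<Rightarrow> complex mat \<Rightarrow> complex mat \<Rightarrow> complex mat \<Rightarrow> complex mat" where
  "reduced_A n k B X Rt P = block_mat_4x4
     B                        (0\<^sub>m n n)    (- 1\<^sub>m n)    (0\<^sub>m n k)
     X                        (0\<^sub>m n n)    (0\<^sub>m n n)    ((- 1\<^sub>m k) @\<^sub>r 0\<^sub>m (n - k) k)
     (0\<^sub>m n n)                (- 1\<^sub>m n)    (0\<^sub>m n n)    (0\<^sub>m n k)
     (Rt * transpose_mat P)   (0\<^sub>m k n)    (0\<^sub>m k n)    (0\<^sub>m k k)"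

definition reduced_B ::
  "nat \<Rightarrow> nat \<Rightarrow> complex mat \<Rightarrow> complex mat \<Rightarrow> complex mat \<Rightarrow> complex mat" where
  "reduced_B n k A Y Qt = block_mat_4x4
     (- A)       (0\<^sub>m n n)              (0\<^sub>m n n)    (0\<^sub>m n k)
     (- Y)       (- mat_adjoint Qt)    (0\<^sub>m n n)    (0\<^sub>m n k)
     (0\<^sub>m n n)   (0\<^sub>m n n)              (- 1\<^sub>m n)    (0\<^sub>m n k)
     (0\<^sub>m k n)   (0\<^sub>m k n)              (0\<^sub>m k n)    (- 1\<^sub>m k)"

definition structured_dB :: "nat \<Rightarrow> nat \<Rightarrow> complex mat \<Rightarrow> complex mat" where
  "structured_dB n k dQ = block_mat_4x4
     (0\<^sub>m n n)   (0\<^sub>m n n)              (0\<^sub>m n n)    (0\<^sub>m n k)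
     (0\<^sub>m n n)   (- mat_adjoint dQ)    (0\<^sub>m n n)    (0\<^sub>m n k)
     (0\<^sub>m n n)   (0\<^sub>m n n)              (0\<^sub>m n n)    (0\<^sub>m n k)
     (0\<^sub>m k n)   (0\<^sub>m k n)              (0\<^sub>m k n)    (0\<^sub>m k k)"

end

theory Submission
  imports Defs "HOL-Analysis.L2_Norm"
begin

text \<open>Everything is built from the exactly unitary factor \<open>Q\<close> of the QR error analysis: with
  \<open>\<delta>Q = Q - \<close> computed factor, \<open>\<delta>D = Q X - D\<close>, \<open>\<delta>C = Q Y - C\<close> and \<open>\<Delta>E\<close> minus the part
  of \<open>E + \<delta>E\<close> cut off by the truncation, premultiplication by \<open>Q\<^sup>*\<close> turns the
  perturbed coefficients into exactly the blocks of the computed reduced pencil. The columns of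
  \<open>\<delta>D\<close> have the norms of those of \<open>Q\<^sup>* \<delta>D\<close>, which consists of the
  orthogonality defect of the computed factor applied to \<open>D\<close> and of the rounding error of the
  product. The zero eigenvalues appear because \<open>\<lambda>\<close> divides the last \<open>n - k\<close> rows of the
  quartic after premultiplication by \<open>Q\<^sup>*\<close>.\<close>

section \<open>Adjoints and unitary matrices\<close>

lemma adjoint_carrier [simp]: "M \<in> carrier_mat m n \<Longrightarrow> mat_adjoint M \<in> carrier_mat n m"
  by (auto simp: mat_adjoint_def mat_of_rows_def)

lemma dim_adjoint [simp]:
  "dim_row (mat_adjoint M) = dim_col M" "dim_col (mat_adjoint M) = dim_row M"
  by (auto simp: mat_adjoint_def mat_of_rows_def)

lemma index_adjoint [simp]:
  "i < dim_col M \<Longrightarrow> j < dim_row M \<Longrightarrow> mat_adjoint M $$ (i, j) = conjugate (M $$ (j, i))"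
  by (auto simp: mat_adjoint_def mat_of_rows_def)

lemma adjoint_minus:
  fixes M N :: "complex mat"
  assumes "M \<in> carrier_mat m n" "N \<in> carrier_mat m n"
  shows "mat_adjoint (M - N) = mat_adjoint M - mat_adjoint N"
  by (rule eq_matI) (use assms in auto)

lemma adjoint_mult:
  fixes M N :: "complex mat"
  assumes "M \<in> carrier_mat l m" "N \<in> carrier_mat m n"
  shows "mat_adjoint (M * N) = mat_adjoint N * mat_adjoint M"
  by (rule eq_matI) (use assms in \<open>auto simp: scalar_prod_def mult.commute\<close>)

lemma adjoint_adjoint [simp]:
  fixes M :: "complex mat"
  shows "mat_adjoint (mat_adjoint M) = M"
  by (rule eq_matI) auto

lemma unitary_adjoint: "unitary_mat n Q \<Longrightarrow> unitary_mat n (mat_adjoint Q)"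
  by (auto simp: unitary_mat_def)

lemma unitary_cancel_left:
  assumes "unitary_mat n Q" "M \<in> carrier_mat n m"
  shows "mat_adjoint Q * (Q * M) = M" "Q * (mat_adjoint Q * M) = M"
proof -
  have Q: "Q \<in> carrier_mat n n" and one: "mat_adjoint Q * Q = 1\<^sub>m n" "Q * mat_adjoint Q = 1\<^sub>m n"
    using assms(1) by (auto simp: unitary_mat_def)
  show "mat_adjoint Q * (Q * M) = M" "Q * (mat_adjoint Q * M) = M"
    using assoc_mult_mat[OF adjoint_carrier[OF Q] Q assms(2)]
      assoc_mult_mat[OF Q adjoint_carrier[OF Q] assms(2)] one assms(2) by simp_all
qed

section \<open>Euclidean and Frobenius norms\<close>

text \<open>Rewriting as \<open>L2_set\<close> makes the Minkowski and Cauchy-Schwarz inequalities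
  for finite sums available.\<close>

lemma vec_norm2_L2_set: "vec_norm2 v = L2_set (\<lambda>i. cmod (v $ i)) {..<dim_vec v}"
  by (simp add: vec_norm2_def L2_set_def)

lemma vec_norm2_nonneg [simp]: "0 \<le> vec_norm2 v"
  by (simp add: vec_norm2_L2_set)

lemma frobenius_norm_L2_set:
  "frobenius_norm M = L2_set (\<lambda>i. L2_set (\<lambda>j. cmod (M $$ (i, j))) {..<dim_col M}) {..<dim_row M}"
  by (simp add: frobenius_norm_def L2_set_def sum_nonneg)

lemma frobenius_norm_nonneg [simp]: "0 \<le> frobenius_norm M"
  by (simp add: frobenius_norm_L2_set)

text \<open>With all entries indexed by one set of pairs, the triangle inequality is a single
  application of Minkowski. The nested form \<open>frobenius_norm_L2_set\<close> serves the
  row-by-row estimates instead.\<close>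

lemma frobenius_norm_L2_set_prod:
  "frobenius_norm M = L2_set (\<lambda>p. cmod (M $$ p)) ({..<dim_row M} \<times> {..<dim_col M})"
  by (simp add: frobenius_norm_def L2_set_def sum.cartesian_product)

lemma frobenius_norm_adjoint: "frobenius_norm (mat_adjoint M) = frobenius_norm M"
proof -
  have "(\<Sum>i<dim_col M. \<Sum>j<dim_row M. (cmod (M $$ (j, i)))\<^sup>2)
      = (\<Sum>i<dim_row M. \<Sum>j<dim_col M. (cmod (M $$ (i, j)))\<^sup>2)"
    by (rule sum.swap)
  then show ?thesis by (simp add: frobenius_norm_def)
qed

lemma vec_norm2_triangle:
  assumes "dim_vec v = dim_vec w"
  shows "vec_norm2 (v + w) \<le> vec_norm2 v + vec_norm2 w"
proof -
  have "vec_norm2 (v + w) \<le> L2_set (\<lambda>i. cmod (v $ i) + cmod (w $ i)) {..<dim_vec w}"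
    unfolding vec_norm2_L2_set by (auto intro!: L2_set_mono norm_triangle_ineq)
  also have "\<dots> \<le> vec_norm2 v + vec_norm2 w"
    unfolding vec_norm2_L2_set assms by (rule L2_set_triangle_ineq)
  finally show ?thesis .
qed

lemma frobenius_norm_triangle:
  assumes "M \<in> carrier_mat m n" "N \<in> carrier_mat m n"
  shows "frobenius_norm (M + N) \<le> frobenius_norm M + frobenius_norm N"
proof -
  have "frobenius_norm (M + N) \<le> L2_set (\<lambda>p. cmod (M $$ p) + cmod (N $$ p)) ({..<m} \<times> {..<n})"
    unfolding frobenius_norm_L2_set_prod using assms
    by (auto intro!: L2_set_mono norm_triangle_ineq)
  also have "\<dots> \<le> frobenius_norm M + frobenius_norm N"
    unfolding frobenius_norm_L2_set_prod using assms by (auto intro!: L2_set_triangle_ineq)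
  finally show ?thesis .
qed

text \<open>Cauchy-Schwarz in each row, then summation of the squares over the rows. Assuming only
  an entrywise bound on \<open>w\<close> covers both a true product (\<open>e = 1\<close>) and a
  rounding error bounded by a multiple of the product of absolute values.\<close>

lemma vec_norm2_le_frobenius:
  assumes "0 \<le> e" "dim_vec w = dim_row M" "dim_vec v = dim_col M"
    and le: "\<And>i. i < dim_row M \<Longrightarrow> cmod (w $ i) \<le> e * (\<Sum>j<dim_col M. cmod (M $$ (i, j)) * cmod (v $ j))"
  shows "vec_norm2 w \<le> e * frobenius_norm M * vec_norm2 v"
proof -
  define a where "a i = L2_set (\<lambda>j. cmod (M $$ (i, j))) {..<dim_col M}" for i
  have "cmod (w $ i) \<le> e * (a i * vec_norm2 v)" if i: "i < dim_row M" for i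
  proof -
    have "(\<Sum>j<dim_col M. cmod (M $$ (i, j)) * cmod (v $ j)) \<le> a i * vec_norm2 v"
      using L2_set_mult_ineq[of "\<lambda>j. cmod (M $$ (i, j))" "\<lambda>j. cmod (v $ j)" "{..<dim_col M}"]
      by (simp add: a_def vec_norm2_L2_set assms)
    then show ?thesis using le[OF i] \<open>0 \<le> e\<close> by (meson mult_left_mono order_trans)
  qed
  then have "vec_norm2 w \<le> L2_set (\<lambda>i. (e * vec_norm2 v) * a i) {..<dim_row M}"
    unfolding vec_norm2_L2_set[of w] assms(2) by (intro L2_set_mono) (auto simp: algebra_simps)
  also have "\<dots> = (e * vec_norm2 v) * frobenius_norm M"
    using \<open>0 \<le> e\<close> by (simp add: L2_set_right_distrib frobenius_norm_L2_set a_def)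
  finally show ?thesis by (simp add: algebra_simps)
qed

lemma vec_norm2_col_mult_le:
  assumes "M \<in> carrier_mat l m" "N \<in> carrier_mat m n" "i < n"
  shows "vec_norm2 (col (M * N) i) \<le> frobenius_norm M * vec_norm2 (col N i)"
proof -
  have "cmod (col (M * N) i $ r) \<le> 1 * (\<Sum>j<dim_col M. cmod (M $$ (r, j)) * cmod (col N i $ j))"
    if "r < dim_row M" for r
    using that assms norm_sum[of "\<lambda>j. M $$ (r, j) * N $$ (j, i)" "{..<m}"]
    by (simp add: scalar_prod_def norm_mult atLeast0LessThan)
  from vec_norm2_le_frobenius[OF _ _ _ this] show ?thesis using assms by simp
qed

text \<open>Column norms are read off the Gram matrix, so that matrix identities such as unitarity
  carry over to norms of single columns.\<close>

lemma adjoint_mult_self_diag: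
  assumes "M \<in> carrier_mat m n" "i < n"
  shows "(mat_adjoint M * M) $$ (i, i) = of_real ((vec_norm2 (col M i))\<^sup>2)"
  using assms
  by (simp add: scalar_prod_def vec_norm2_def sum_nonneg atLeast0LessThan
      complex_norm_square mult.commute del: of_real_power)

text \<open>\<open>Q * M\<close> and \<open>M\<close> have the same Gram matrix, hence the same
  diagonal.\<close>

lemma vec_norm2_col_unitary:
  assumes Q: "unitary_mat n Q" and M: "M \<in> carrier_mat n m" and i: "i < m"
  shows "vec_norm2 (col (Q * M) i) = vec_norm2 (col M i)"
proof -
  have c: "Q \<in> carrier_mat n n" using Q by (simp add: unitary_mat_def)
  have "mat_adjoint (Q * M) * (Q * M) = mat_adjoint M * (mat_adjoint Q * (Q * M))"
    using c M by (simp add: adjoint_mult[OF c M] assoc_mult_mat[of _ m n _ n _ m])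
  also have "\<dots> = mat_adjoint M * M"
    using unitary_cancel_left[OF Q M] by simp
  finally have eq: "mat_adjoint (Q * M) * (Q * M) = mat_adjoint M * M" .
  have "complex_of_real ((vec_norm2 (col (Q * M) i))\<^sup>2) = of_real ((vec_norm2 (col M i))\<^sup>2)"
    using adjoint_mult_self_diag[OF M i] adjoint_mult_self_diag[of "Q * M" n m i] c M i eq by simp
  then have "(vec_norm2 (col (Q * M) i))\<^sup>2 = (vec_norm2 (col M i))\<^sup>2"
    using of_real_eq_iff by blast
  then show ?thesis by simp
qed

text \<open>The Gram matrix of \<open>Q\<close> is the identity, so each of the \<open>n\<close>
  columns contributes 1 to the squared norm.\<close>

lemma frobenius_norm_unitary:
  assumes "unitary_mat n Q"
  shows "frobenius_norm Q = sqrt (real n)"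
proof -
  have c: "Q \<in> carrier_mat n n" using assms by (simp add: unitary_mat_def)
  have "complex_of_real ((vec_norm2 (col Q j))\<^sup>2) = of_real 1" if "j < n" for j
    using adjoint_mult_self_diag[OF c that] assms that by (simp add: unitary_mat_def)
  then have n: "(vec_norm2 (col Q j))\<^sup>2 = 1" if "j < n" for j
    using that of_real_eq_iff by blast
  have "(\<Sum>i<n. \<Sum>j<n. (cmod (Q $$ (i, j)))\<^sup>2) = (\<Sum>j<n. \<Sum>i<n. (cmod (Q $$ (i, j)))\<^sup>2)"
    by (rule sum.swap)
  also have "\<dots> = (\<Sum>j<n. (vec_norm2 (col Q j))\<^sup>2)"
    using c by (intro sum.cong) (auto simp: vec_norm2_def sum_nonneg)
  also have "\<dots> = real n" by (simp add: n)
  finally show ?thesis using c by (simp add: frobenius_norm_def)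
qed

section \<open>Backward error of a computed product\<close>

text \<open>After multiplication by the adjoint of \<open>Qh\<close>, which keeps column norms, the
  error splits into the deviation of \<open>Qt\<close> from \<open>Qh\<close> applied to
  \<open>M\<close> and the rounding error \<open>d0\<close>. The first gives the summand
  \<open>e\<close>; the second gives \<open>c * real n * u\<close> times a bound for the Frobenius
  norm of \<open>Qt\<close>.\<close>

lemma computed_product_backward_error:
  assumes Qh: "unitary_mat n Qh" and Qt: "Qt \<in> carrier_mat n n" and M: "M \<in> carrier_mat n n"
    and e: "frobenius_norm (Qt - Qh) \<le> e" and cu: "0 \<le> c * real n * u"
    and X: "computed_adjoint_product n c u Qt M X" and i: "i < n"
  shows "vec_norm2 (col (Qh * X - M) i)
    \<le> (e + c * real n * u * (sqrt (real n) + e)) * vec_norm2 (col M i)"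
proof -
  obtain \<epsilon> d0 where \<epsilon>: "0 \<le> \<epsilon>" "\<epsilon> \<le> c * real n * u" and d0: "d0 \<in> carrier_mat n n"
    and le: "mat_entrywise_le (abs_mat d0) (\<epsilon> \<cdot>\<^sub>m (abs_mat (mat_adjoint Qt) * abs_mat M))"
    and Xd: "X = mat_adjoint Qt * M + d0"
    using X unfolding computed_adjoint_product_def by auto
  have Qhc: "Qh \<in> carrier_mat n n" using Qh by (simp add: unitary_mat_def)
  have Xc: "X \<in> carrier_mat n n" using Xd d0 by simp
  let ?w = "vec_norm2 (col M i)"
  have dif: "mat_adjoint Qh * (Qh * X - M) = mat_adjoint (Qt - Qh) * M + d0"
  proof -
    have "mat_adjoint Qh * (Qh * X - M) = mat_adjoint Qh * (Qh * X) - mat_adjoint Qh * M"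
      using Qhc Xc M by (intro mult_minus_distrib_mat) auto
    also have "\<dots> = mat_adjoint Qt * M + d0 - mat_adjoint Qh * M"
      by (subst unitary_cancel_left(1)[OF Qh Xc]) (simp add: Xd)
    also have "\<dots> = (mat_adjoint Qt * M - mat_adjoint Qh * M) + d0"
      by (rule eq_matI) (use Qhc Qt M d0 in auto)
    also have "\<dots> = mat_adjoint (Qt - Qh) * M + d0"
      using Qhc Qt M by (simp add: adjoint_minus[OF Qt Qhc] minus_mult_distrib_mat[of _ n n _ _ n])
    finally show ?thesis .
  qed
  \<comment> \<open>\<open>Qt\<close> is only nearly unitary, so its norm is that of
    \<open>Qh\<close> plus the deviation.\<close>
  have fQt: "frobenius_norm Qt \<le> sqrt (real n) + e"
  proof -
    have "frobenius_norm (Qh + (Qt - Qh)) \<le> frobenius_norm Qh + frobenius_norm (Qt - Qh)"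
      by (rule frobenius_norm_triangle) (use Qhc Qt in auto)
    moreover have "Qh + (Qt - Qh) = Qt" by (rule eq_matI) (use Qhc Qt in auto)
    ultimately have "frobenius_norm Qt \<le> frobenius_norm Qh + frobenius_norm (Qt - Qh)" by simp
    then show ?thesis using e frobenius_norm_unitary[OF Qh] by simp
  qed
  have "vec_norm2 (col d0 i) \<le> \<epsilon> * frobenius_norm (mat_adjoint Qt) * ?w"
  proof (rule vec_norm2_le_frobenius)
    \<comment> \<open>The entrywise rounding bound, restricted to column \<open>i\<close>, has
      exactly the form that the row estimate requires.\<close>
    fix r assume r: "r < dim_row (mat_adjoint Qt)"
    then have "abs_mat d0 $$ (r, i) \<le> (\<epsilon> \<cdot>\<^sub>m (abs_mat (mat_adjoint Qt) * abs_mat M)) $$ (r, i)"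
      using le d0 Qt i unfolding mat_entrywise_le_def by (auto simp: abs_mat_def)
    then show "cmod (col d0 i $ r) \<le> \<epsilon> * (\<Sum>j<dim_col (mat_adjoint Qt).
        cmod (mat_adjoint Qt $$ (r, j)) * cmod (col M i $ j))"
      using r d0 Qt M i by (simp add: abs_mat_def scalar_prod_def atLeast0LessThan)
  qed (use \<epsilon> d0 Qt M in auto)
  also have "\<dots> \<le> c * real n * u * (sqrt (real n) + e) * ?w"
    \<comment> \<open>Nonnegativity of \<open>e\<close> comes from the norm that it bounds.\<close>
    using \<epsilon> fQt cu e frobenius_norm_nonneg[of "Qt - Qh"]
    by (intro mult_right_mono mult_mono) (auto simp: frobenius_norm_adjoint)
  finally have nd: "vec_norm2 (col d0 i) \<le> c * real n * u * (sqrt (real n) + e) * ?w" .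
  have "vec_norm2 (col (mat_adjoint (Qt - Qh) * M) i) \<le> frobenius_norm (mat_adjoint (Qt - Qh)) * ?w"
    using Qhc M i by (intro vec_norm2_col_mult_le) auto
  also have "\<dots> \<le> e * ?w" using e by (simp add: frobenius_norm_adjoint mult_right_mono)
  finally have nm: "vec_norm2 (col (mat_adjoint (Qt - Qh) * M) i) \<le> e * ?w" .
  have "vec_norm2 (col (Qh * X - M) i) = vec_norm2 (col (mat_adjoint Qh * (Qh * X - M)) i)"
    using vec_norm2_col_unitary[OF unitary_adjoint[OF Qh] minus_carrier_mat[OF M] i] by simp
  also have "\<dots> = vec_norm2 (col (mat_adjoint (Qt - Qh) * M) i + col d0 i)"
    unfolding dif by (subst col_add[of _ n n]) (use M d0 Qhc i in auto)
  also have "\<dots> \<le> vec_norm2 (col (mat_adjoint (Qt - Qh) * M) i) + vec_norm2 (col d0 i)"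
    using Qhc d0 by (intro vec_norm2_triangle) auto
  finally show ?thesis using nd nm by (simp add: algebra_simps)
qed

section \<open>Pencils and their constant equivalence transformations\<close>

lemma const_mat_carrier [simp]: "const_mat M \<in> carrier_mat m n \<longleftrightarrow> M \<in> carrier_mat m n"
  by (auto simp: const_mat_def)

lemma const_mat_mult:
  assumes "M \<in> carrier_mat l m" "N \<in> carrier_mat m n"
  shows "const_mat (M * N) = const_mat M * const_mat N"
proof -
  have sum: "(\<Sum>x\<in>S. [:f x:]) = [:\<Sum>x\<in>S. f x:]" for S and f :: "nat \<Rightarrow> complex"
    by (induction S rule: infinite_finite_induct) auto
  show ?thesis
    by (rule eq_matI) (use assms in \<open>auto simp: const_mat_def scalar_prod_def sum mult.commute\<close>)
qed

text \<open>Constant factors pass through the variable, so an equivalence of pencils reduces to two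
  identities between complex matrices.\<close>

lemma pencil_equiv:
  assumes S: "S \<in> carrier_mat m m" and T: "T \<in> carrier_mat m m"
    and M: "M \<in> carrier_mat m m" and N: "N \<in> carrier_mat m m"
  shows "const_mat S * pencil M N * const_mat T = pencil (S * M * T) (S * N * T)"
proof -
  let ?x = "monom 1 1 :: complex poly"
  have "const_mat S * pencil M N = const_mat (S * M) - ?x \<cdot>\<^sub>m const_mat (S * N)"
    unfolding pencil_def using S M N
    by (simp add: mult_minus_distrib_mat[of _ m m _ m] mult_smult_distrib[of _ m m _ m]
        const_mat_mult[of _ m m _ m])
  then show ?thesis
    unfolding pencil_def using S M N T
    by (simp add: minus_mult_distrib_mat[of _ m m _ _ m] mult_smult_assoc_mat[of _ m m _ m]
        const_mat_mult[of _ m m _ m])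
qed

lemma pencil_four_block:
  assumes "A1 \<in> carrier_mat m n" "B1 \<in> carrier_mat m n'" "C1 \<in> carrier_mat m' n" "D1 \<in> carrier_mat m' n'"
    "A2 \<in> carrier_mat m n" "B2 \<in> carrier_mat m n'" "C2 \<in> carrier_mat m' n" "D2 \<in> carrier_mat m' n'"
  shows "pencil (four_block_mat A1 B1 C1 D1) (four_block_mat A2 B2 C2 D2)
    = four_block_mat (pencil A1 A2) (pencil B1 B2) (pencil C1 C2) (pencil D1 D2)"
  by (rule eq_matI) (use assms in \<open>auto simp: pencil_def const_mat_def\<close>)

lemma pencil_zero: "pencil (0\<^sub>m m n) (0\<^sub>m m n) = 0\<^sub>m m n"
  by (rule eq_matI) (auto simp: pencil_def const_mat_def)

section \<open>Products of 4 by 4 block matrices\<close>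

text \<open>\<open>diag_block_mat\<close> splits off one block at a time, while
  \<open>block_mat_4x4\<close> nests 2 by 2 blocks; this reconciles the two shapes before
  multiplying.\<close>

lemma diag_block_mat_4:
  assumes "a \<in> carrier_mat n n" "b \<in> carrier_mat n n" "c \<in> carrier_mat n n" "d \<in> carrier_mat n n"
  shows "diag_block_mat [a, b, c, d] = block_mat_4x4
    a (0\<^sub>m n n) (0\<^sub>m n n) (0\<^sub>m n n)
    (0\<^sub>m n n) b (0\<^sub>m n n) (0\<^sub>m n n)
    (0\<^sub>m n n) (0\<^sub>m n n) c (0\<^sub>m n n)
    (0\<^sub>m n n) (0\<^sub>m n n) (0\<^sub>m n n) d"
  by (rule eq_matI) (use assms in \<open>auto simp: block_mat_4x4_def Let_def\<close>)

lemma block_mat_4x4_carrier: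
  assumes "M11 \<in> carrier_mat n n" "M22 \<in> carrier_mat n n" "M33 \<in> carrier_mat n n" "M44 \<in> carrier_mat m m"
  shows "block_mat_4x4 M11 M12 M13 M14 M21 M22 M23 M24 M31 M32 M33 M34 M41 M42 M43 M44
    \<in> carrier_mat (3 * n + m) (3 * n + m)"
  using assms by (auto simp: block_mat_4x4_def)

lemma block_diag_mult:
  fixes a b :: "'a :: comm_ring_1 mat"
  assumes a: "a \<in> carrier_mat m m" and b: "b \<in> carrier_mat m' m'"
    and M: "M1 \<in> carrier_mat m m" "M2 \<in> carrier_mat m m'" "M3 \<in> carrier_mat m' m" "M4 \<in> carrier_mat m' m'"
  shows "four_block_mat a (0\<^sub>m m m') (0\<^sub>m m' m) b * four_block_mat M1 M2 M3 M4
      = four_block_mat (a * M1) (a * M2) (b * M3) (b * M4)"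
    and "four_block_mat M1 M2 M3 M4 * four_block_mat a (0\<^sub>m m m') (0\<^sub>m m' m) b
      = four_block_mat (M1 * a) (M2 * b) (M3 * a) (M4 * b)"
  using mult_four_block_mat[OF a zero_carrier_mat zero_carrier_mat b M]
    mult_four_block_mat[OF M a zero_carrier_mat zero_carrier_mat b] a b M
  by simp_all

lemma diag_mult_block_mat_4x4:
  fixes a b c d :: "'a :: comm_ring_1 mat"
  assumes "a \<in> carrier_mat n n" "b \<in> carrier_mat n n" "c \<in> carrier_mat n n" "d \<in> carrier_mat n n"
    and M: "M11 \<in> carrier_mat n n" "M12 \<in> carrier_mat n n" "M13 \<in> carrier_mat n n" "M14 \<in> carrier_mat n n"
      "M21 \<in> carrier_mat n n" "M22 \<in> carrier_mat n n" "M23 \<in> carrier_mat n n" "M24 \<in> carrier_mat n n"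
      "M31 \<in> carrier_mat n n" "M32 \<in> carrier_mat n n" "M33 \<in> carrier_mat n n" "M34 \<in> carrier_mat n n"
      "M41 \<in> carrier_mat n n" "M42 \<in> carrier_mat n n" "M43 \<in> carrier_mat n n" "M44 \<in> carrier_mat n n"
  shows "diag_block_mat [a, b, c, d] *
      block_mat_4x4 M11 M12 M13 M14 M21 M22 M23 M24 M31 M32 M33 M34 M41 M42 M43 M44 =
    block_mat_4x4 (a * M11) (a * M12) (a * M13) (a * M14) (b * M21) (b * M22) (b * M23) (b * M24)
      (c * M31) (c * M32) (c * M33) (c * M34) (d * M41) (d * M42) (d * M43) (d * M44)"
    and "block_mat_4x4 M11 M12 M13 M14 M21 M22 M23 M24 M31 M32 M33 M34 M41 M42 M43 M44
      * diag_block_mat [a, b, c, d] =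
    block_mat_4x4 (M11 * a) (M12 * b) (M13 * c) (M14 * d) (M21 * a) (M22 * b) (M23 * c) (M24 * d)
      (M31 * a) (M32 * b) (M33 * c) (M34 * d) (M41 * a) (M42 * b) (M43 * c) (M44 * d)"
proof -
  \<comment> \<open>The 2 by 2 block product is used on two levels: once with blocks of order
    \<open>n + n\<close>, then inside each of these with blocks of order \<open>n\<close>.\<close>
  note outer = block_diag_mult[where m = "n + n" and m' = "n + n"]
    and inner = block_diag_mult[where m = n and m' = n, OF assms(1,2)]
      block_diag_mult[where m = n and m' = n, OF assms(3,4)]
  show "diag_block_mat [a, b, c, d] *
      block_mat_4x4 M11 M12 M13 M14 M21 M22 M23 M24 M31 M32 M33 M34 M41 M42 M43 M44 =
    block_mat_4x4 (a * M11) (a * M12) (a * M13) (a * M14) (b * M21) (b * M22) (b * M23) (b * M24)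
      (c * M31) (c * M32) (c * M33) (c * M34) (d * M41) (d * M42) (d * M43) (d * M44)"
    unfolding diag_block_mat_4[OF assms(1-4)] block_mat_4x4_def four_block_zero_mat
    by (subst outer(1)) (use assms in \<open>simp_all add: inner M\<close>)
  show "block_mat_4x4 M11 M12 M13 M14 M21 M22 M23 M24 M31 M32 M33 M34 M41 M42 M43 M44
      * diag_block_mat [a, b, c, d] =
    block_mat_4x4 (M11 * a) (M12 * b) (M13 * c) (M14 * d) (M21 * a) (M22 * b) (M23 * c) (M24 * d)
      (M31 * a) (M32 * b) (M33 * c) (M34 * d) (M41 * a) (M42 * b) (M43 * c) (M44 * d)"
    unfolding diag_block_mat_4[OF assms(1-4)] block_mat_4x4_def four_block_zero_mat
    by (subst outer(2)) (use assms in \<open>simp_all add: inner M\<close>)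
qed

section \<open>Zero eigenvalues of the quartic\<close>

text \<open>Every term of the Leibniz expansion takes one factor from each of the rows
  \<open>k\<close> to \<open>n - 1\<close>, all of them multiples of \<open>x\<close>.\<close>

lemma power_dvd_det:
  fixes A :: "'a :: comm_ring_1 mat"
  assumes A: "A \<in> carrier_mat n n" and dvd: "\<And>i j. k \<le> i \<Longrightarrow> i < n \<Longrightarrow> j < n \<Longrightarrow> x dvd A $$ (i, j)"
  shows "x ^ (n - k) dvd det A"
  unfolding det_def'[OF A]
proof (intro dvd_sum dvd_mult)
  fix p assume "p \<in> {p. p permutes {0..<n}}"
  then have p: "p i < n" if "i < n" for i
    using that permutes_in_image[of p "{0..<n}" i] by auto
  have "x ^ (n - k) = (\<Prod>i = k..<n. x)" by simp
  also have "\<dots> dvd (\<Prod>i = k..<n. A $$ (i, p i))"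
    using p dvd by (intro prod_dvd_prod) auto
  also have "\<dots> dvd (\<Prod>i = 0..<n. A $$ (i, p i))"
    by (intro prod_dvd_prod_subset) auto
  finally show "x ^ (n - k) dvd (\<Prod>i = 0..<n. A $$ (i, p i))" .
qed

text \<open>The constant coefficient of the transformed quartic is \<open>mat_adjoint Q * E\<close>,
  whose rows from \<open>k\<close> on vanish. Each of these rows is therefore divisible by the
  variable, and multiplying back by \<open>Q\<close> only contributes the factor
  \<open>det (const_mat Q)\<close>.\<close>

lemma zero_eigenvalues_quartic:
  assumes Q: "unitary_mat n Q"
    and c: "A \<in> carrier_mat n n" "B \<in> carrier_mat n n" "C \<in> carrier_mat n n"
      "D \<in> carrier_mat n n" "E \<in> carrier_mat n n"
    and zero: "\<And>i j. k \<le> i \<Longrightarrow> i < n \<Longrightarrow> j < n \<Longrightarrow> (mat_adjoint Q * E) $$ (i, j) = 0"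
  shows "zero_eigenvalues_at_least (n - k) (quartic A B C D E)"
proof -
  let ?P = "quartic A B C D E"
  let ?G = "const_mat (mat_adjoint Q) * ?P"
  have Qc: "Q \<in> carrier_mat n n" "mat_adjoint Q \<in> carrier_mat n n"
    using Q by (auto simp: unitary_mat_def)
  have P: "?P \<in> carrier_mat n n" using c by (simp add: quartic_def)
  have G: "?G \<in> carrier_mat n n" using Qc P by (intro mult_carrier_mat[of _ n n]) simp_all
  have P0: "poly (?P $$ (i, j)) 0 = E $$ (i, j)" if "i < n" "j < n" for i j
    using that c by (simp add: quartic_def const_mat_def poly_monom)
  have "const_mat Q * const_mat (mat_adjoint Q) = 1\<^sub>m n"
    using Q Qc by (auto simp: const_mat_mult[symmetric, OF Qc] unitary_mat_def)
      (auto simp: const_mat_def one_pCons)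
  then have "?P = const_mat Q * ?G"
    using Qc P assoc_mult_mat[of "const_mat Q" n n "const_mat (mat_adjoint Q)" n ?P n] by simp
  then have det: "det ?P = det (const_mat Q) * det ?G"
    using Qc G det_mult[of "const_mat Q" n ?G] by simp
  \<comment> \<open>Divisibility by the variable is vanishing at 0, and evaluation at 0 keeps only
    the term with \<open>E\<close>.\<close>
  have "[:0, 1:] dvd ?G $$ (i, j)" if ij: "k \<le> i" "i < n" "j < n" for i j
  proof -
    have "poly (?G $$ (i, j)) 0 = (mat_adjoint Q * E) $$ (i, j)"
      using ij Qc P c by (simp add: const_mat_def scalar_prod_def poly_sum P0)
    then show ?thesis using zero[OF ij] poly_eq_0_iff_dvd[of "?G $$ (i, j)" 0] by simp
  qed
  then have "[:0, 1:] ^ (n - k) dvd det ?G"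
    using G by (intro power_dvd_det[of _ n])
  then show ?thesis
    unfolding zero_eigenvalues_at_least_def det by (simp add: monom_altdef)
qed

section \<open>Splitting off the deflated block\<close>

text \<open>Splitting the last block row and column after \<open>k\<close> indices exposes the zero
  rows of \<open>S\<close>. The only entries left above the deflated block come from the
  \<open>- 1\<^sub>m n\<close> in the second block row: its column \<open>k + j\<close> has its
  nonzero entry in global row \<open>n + k + j\<close>.\<close>

lemma deflate_A:
  assumes "k \<le> n" "B \<in> carrier_mat n n" "X \<in> carrier_mat n n" "S \<in> carrier_mat n n" "P \<in> carrier_mat n n"
    "Rt \<in> carrier_mat k n"
    and top: "\<And>i j. i < k \<Longrightarrow> j < n \<Longrightarrow> S $$ (i, j) = (Rt * transpose_mat P) $$ (i, j)"
    and bottom: "\<And>i j. k \<le> i \<Longrightarrow> i < n \<Longrightarrow> j < n \<Longrightarrow> S $$ (i, j) = 0"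
  shows "block_mat_4x4
     B           (0\<^sub>m n n)    (- 1\<^sub>m n)    (0\<^sub>m n n)
     X           (0\<^sub>m n n)    (0\<^sub>m n n)    (- 1\<^sub>m n)
     (0\<^sub>m n n)   (- 1\<^sub>m n)    (0\<^sub>m n n)    (0\<^sub>m n n)
     S           (0\<^sub>m n n)    (0\<^sub>m n n)    (0\<^sub>m n n)
    = four_block_mat (reduced_A n k B X Rt P)
        (mat (3 * n + k) (n - k) (\<lambda>(i, j). if i = n + k + j then - 1 else 0))
        (0\<^sub>m (n - k) (3 * n + k)) (0\<^sub>m (n - k) (n - k))"
proof -
  \<comment> \<open>Naming the product keeps its entries atomic when the block indices are
    simplified.\<close>
  define F where "F = Rt * transpose_mat P"
  have F: "F \<in> carrier_mat k n" using assms by (simp add: F_def)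
  show ?thesis
    unfolding reduced_A_def F_def[symmetric]
    by (rule eq_matI)
      (use assms(1-5) F top[folded F_def] bottom in \<open>auto simp: block_mat_4x4_def append_rows_def not_less\<close>)
qed

text \<open>The last diagonal block \<open>- 1\<^sub>m n\<close> splits into orders \<open>k\<close>
  and \<open>n - k\<close> without coupling. The sum \<open>V\<close> is distributed over the
  computed block and the structured perturbation.\<close>

lemma deflate_B:
  assumes "k \<le> n" "A \<in> carrier_mat n n" "Y \<in> carrier_mat n n" "Qt \<in> carrier_mat n n" "dQ \<in> carrier_mat n n"
    and V: "V = - mat_adjoint Qt + (- mat_adjoint dQ)"
  shows "block_mat_4x4
     (- A)       (0\<^sub>m n n)    (0\<^sub>m n n)    (0\<^sub>m n n)
     (- Y)       V           (0\<^sub>m n n)    (0\<^sub>m n n)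
     (0\<^sub>m n n)   (0\<^sub>m n n)    (- 1\<^sub>m n)    (0\<^sub>m n n)
     (0\<^sub>m n n)   (0\<^sub>m n n)    (0\<^sub>m n n)    (- 1\<^sub>m n)
    = four_block_mat (reduced_B n k A Y Qt + structured_dB n k dQ)
        (0\<^sub>m (3 * n + k) (n - k)) (0\<^sub>m (n - k) (3 * n + k)) (- 1\<^sub>m (n - k))"
proof -
  define a b where "a = mat_adjoint Qt" and "b = mat_adjoint dQ"
  have ab: "a \<in> carrier_mat n n" "b \<in> carrier_mat n n"
    using assms by (auto simp: a_def b_def)
  show ?thesis
    unfolding reduced_B_def structured_dB_def V a_def[symmetric] b_def[symmetric]
    by (rule eq_matI) (use assms(1-3) ab in \<open>auto simp: block_mat_4x4_def not_less\<close>)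
qed

text \<open>Used to undo the column pivoting when the truncated factor is multiplied by
  \<open>P\<close> again.\<close>

lemma permutation_mat_transpose_mult:
  assumes "permutation_mat n P"
  shows "P \<in> carrier_mat n n" "transpose_mat P * P = 1\<^sub>m n"
proof -
  obtain p where p: "p permutes {..<n}" and P: "P = mat n n (\<lambda>(i, j). if i = p j then 1 else 0)"
    using assms unfolding permutation_mat_def by auto
  show "P \<in> carrier_mat n n" by (simp add: P)
  have lt: "p i < n" if "i < n" for i using that permutes_in_image[OF p, of i] by simp
  have inj: "p i = p j \<longleftrightarrow> i = j" for i j using permutes_inj[OF p] by (auto simp: inj_def)
  show "transpose_mat P * P = 1\<^sub>m n"
  proof (rule eq_matI)
    fix i j assume "i < dim_row (1\<^sub>m n :: complex mat)" "j < dim_col (1\<^sub>m n :: complex mat)"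
    then have ij: "i < n" "j < n" by auto
    have "(transpose_mat P * P) $$ (i, j)
        = (\<Sum>l = 0..<n. (if l = p i then 1 else 0) * (if l = p j then 1 else 0))"
      using ij by (simp add: P scalar_prod_def)
    also have "\<dots> = (\<Sum>l = 0..<n. if l = p i then (if i = j then 1 else 0) else 0)"
      by (rule sum.cong) (auto simp: inj)
    also have "\<dots> = 1\<^sub>m n $$ (i, j)" using ij lt by simp
    finally show "(transpose_mat P * P) $$ (i, j) = 1\<^sub>m n $$ (i, j)" .
  qed (auto simp: P)
qed

section \<open>The exact reduced linearization\<close>

text \<open>The required unitary matrix is \<open>Q\<close> itself. In the second and fourth block
  rows its adjoint produces the transformed coefficients, and \<open>Q\<close> in the last block
  column restores the identity blocks there. In the middle block of the second matrix the adjoint of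
  \<open>Q\<close> remains; it is the adjoint of \<open>Qt\<close> plus that of
  \<open>Q - Qt\<close>, which is the structured perturbation.\<close>

lemma exact_reduced_linearizationI:
  assumes Q: "unitary_mat n Q" and k: "k \<le> n"
    and c: "A \<in> carrier_mat n n" "B \<in> carrier_mat n n" "C \<in> carrier_mat n n"
      "D \<in> carrier_mat n n" "E \<in> carrier_mat n n"
    and Qt: "Qt \<in> carrier_mat n n" and P: "P \<in> carrier_mat n n" and Rt: "Rt \<in> carrier_mat k n"
    and top: "\<And>i j. i < k \<Longrightarrow> j < n \<Longrightarrow> (mat_adjoint Q * E) $$ (i, j) = (Rt * transpose_mat P) $$ (i, j)"
    and bottom: "\<And>i j. k \<le> i \<Longrightarrow> i < n \<Longrightarrow> j < n \<Longrightarrow> (mat_adjoint Q * E) $$ (i, j) = 0"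
  shows "exact_reduced_linearization n k (reduced_A n k B (mat_adjoint Q * D) Rt P)
    (reduced_B n k A (mat_adjoint Q * C) Qt + structured_dB n k (Q - Qt)) A B C D E"
proof -
  have Qc: "Q \<in> carrier_mat n n" and Qa: "mat_adjoint Q \<in> carrier_mat n n"
    and one: "mat_adjoint Q * Q = 1\<^sub>m n"
    using Q by (auto simp: unitary_mat_def)
  have QM: "mat_adjoint Q * C \<in> carrier_mat n n" "mat_adjoint Q * D \<in> carrier_mat n n"
    "mat_adjoint Q * E \<in> carrier_mat n n"
    using Qa c by auto
  let ?S = "diag_block_mat [1\<^sub>m n, mat_adjoint Q, 1\<^sub>m n, mat_adjoint Q]"
  let ?T = "diag_block_mat [1\<^sub>m n, 1\<^sub>m n, 1\<^sub>m n, Q]"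
  let ?M = "reduced_A n k B (mat_adjoint Q * D) Rt P"
  let ?N = "reduced_B n k A (mat_adjoint Q * C) Qt + structured_dB n k (Q - Qt)"
  \<comment> \<open>\<open>UA\<close> and \<open>UB\<close> are the coefficients of the coupling
    block \<open>U\<close> above the deflated part.\<close>
  define UA :: "complex mat"
    where "UA = mat (3 * n + k) (n - k) (\<lambda>(i, j). if i = n + k + j then - 1 else 0)"
  define UB :: "complex mat" where "UB = 0\<^sub>m (3 * n + k) (n - k)"
  have neg: "mat_adjoint Q * - 1\<^sub>m n = - mat_adjoint Q" "- mat_adjoint Q * Q = - 1\<^sub>m n"
    "- 1\<^sub>m n * Q = - Q"  "mat_adjoint Q * - Q = - 1\<^sub>m n" "- 1\<^sub>m n * 1\<^sub>m n = (- 1\<^sub>m n :: complex mat)"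
    "1\<^sub>m n * - 1\<^sub>m n = (- 1\<^sub>m n :: complex mat)" "mat_adjoint Q * - C = - (mat_adjoint Q * C)"
    using Qc Qa c by (simp_all add: one)
  \<comment> \<open>The exact unitary block is the computed one plus the perturbation.\<close>
  have V: "- mat_adjoint Q = - mat_adjoint Qt + - mat_adjoint (Q - Qt)"
    by (rule eq_matI) (use Qc Qt in auto)
  have sA: "?S * linearization_A n B D E * ?T = four_block_mat ?M UA
      (0\<^sub>m (n - k) (3 * n + k)) (0\<^sub>m (n - k) (n - k))"
  proof -
    have "?S * linearization_A n B D E = block_mat_4x4
     B                     (0\<^sub>m n n)    (- 1\<^sub>m n)    (0\<^sub>m n n)
     (mat_adjoint Q * D)   (0\<^sub>m n n)    (0\<^sub>m n n)    (- mat_adjoint Q)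
     (0\<^sub>m n n)             (- 1\<^sub>m n)    (0\<^sub>m n n)    (0\<^sub>m n n)
     (mat_adjoint Q * E)   (0\<^sub>m n n)    (0\<^sub>m n n)    (0\<^sub>m n n)"
      unfolding linearization_A_def
      by (subst diag_mult_block_mat_4x4(1)[of _ n]) (use Qc Qa c in \<open>simp_all add: neg\<close>)
    then have "?S * linearization_A n B D E * ?T = block_mat_4x4
     B                     (0\<^sub>m n n)    (- 1\<^sub>m n)    (0\<^sub>m n n)
     (mat_adjoint Q * D)   (0\<^sub>m n n)    (0\<^sub>m n n)    (- mat_adjoint Q)
     (0\<^sub>m n n)             (- 1\<^sub>m n)    (0\<^sub>m n n)    (0\<^sub>m n n)
     (mat_adjoint Q * E)   (0\<^sub>m n n)    (0\<^sub>m n n)    (0\<^sub>m n n) * ?T"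
      by simp
    also have "\<dots> = block_mat_4x4
     B                     (0\<^sub>m n n)    (- 1\<^sub>m n)    (0\<^sub>m n n)
     (mat_adjoint Q * D)   (0\<^sub>m n n)    (0\<^sub>m n n)    (- 1\<^sub>m n)
     (0\<^sub>m n n)             (- 1\<^sub>m n)    (0\<^sub>m n n)    (0\<^sub>m n n)
     (mat_adjoint Q * E)   (0\<^sub>m n n)    (0\<^sub>m n n)    (0\<^sub>m n n)"
      by (subst diag_mult_block_mat_4x4(2)[of _ n]) (use Qc Qa QM c in \<open>simp_all add: neg one\<close>)
    also have "\<dots> = four_block_mat ?M UA (0\<^sub>m (n - k) (3 * n + k)) (0\<^sub>m (n - k) (n - k))"
      unfolding UA_def by (rule deflate_A) (use k c Qa P Rt top bottom in auto)
    finally show ?thesis .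
  qed
  have sB: "?S * linearization_B n A C * ?T = four_block_mat ?N UB
      (0\<^sub>m (n - k) (3 * n + k)) (- 1\<^sub>m (n - k))"
  proof -
    have "?S * linearization_B n A C = block_mat_4x4
     (- A)                     (0\<^sub>m n n)           (0\<^sub>m n n)    (0\<^sub>m n n)
     (- (mat_adjoint Q * C))   (- mat_adjoint Q)   (0\<^sub>m n n)    (0\<^sub>m n n)
     (0\<^sub>m n n)                 (0\<^sub>m n n)           (- 1\<^sub>m n)    (0\<^sub>m n n)
     (0\<^sub>m n n)                 (0\<^sub>m n n)           (0\<^sub>m n n)    (- mat_adjoint Q)"
      unfolding linearization_B_def
      by (subst diag_mult_block_mat_4x4(1)[of _ n]) (use Qc Qa c in \<open>simp_all add: neg\<close>)
    then have "?S * linearization_B n A C * ?T = block_mat_4x4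
     (- A)                     (0\<^sub>m n n)           (0\<^sub>m n n)    (0\<^sub>m n n)
     (- (mat_adjoint Q * C))   (- mat_adjoint Q)   (0\<^sub>m n n)    (0\<^sub>m n n)
     (0\<^sub>m n n)                 (0\<^sub>m n n)           (- 1\<^sub>m n)    (0\<^sub>m n n)
     (0\<^sub>m n n)                 (0\<^sub>m n n)           (0\<^sub>m n n)    (- mat_adjoint Q) * ?T"
      by simp
    also have "\<dots> = block_mat_4x4
     (- A)                     (0\<^sub>m n n)           (0\<^sub>m n n)    (0\<^sub>m n n)
     (- (mat_adjoint Q * C))   (- mat_adjoint Q)   (0\<^sub>m n n)    (0\<^sub>m n n)
     (0\<^sub>m n n)                 (0\<^sub>m n n)           (- 1\<^sub>m n)    (0\<^sub>m n n)
     (0\<^sub>m n n)                 (0\<^sub>m n n)           (0\<^sub>m n n)    (- 1\<^sub>m n)"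
      by (subst diag_mult_block_mat_4x4(2)[of _ n]) (use Qc Qa QM c in \<open>simp_all add: neg one\<close>)
    also have "\<dots> = four_block_mat ?N UB (0\<^sub>m (n - k) (3 * n + k)) (- 1\<^sub>m (n - k))"
      unfolding UB_def by (rule deflate_B) (use k c Qc Qa Qt V in auto)
    finally show ?thesis .
  qed
  have M: "?M \<in> carrier_mat (3 * n + k) (3 * n + k)"
    unfolding reduced_A_def by (rule block_mat_4x4_carrier) (use c in auto)
  have N: "?N \<in> carrier_mat (3 * n + k) (3 * n + k)"
    unfolding structured_dB_def
    by (intro add_carrier_mat block_mat_4x4_carrier) (use Qc Qt in auto)
  have "const_mat ?S * pencil (linearization_A n B D E) (linearization_B n A C) * const_mat ?T
      = pencil (?S * linearization_A n B D E * ?T) (?S * linearization_B n A C * ?T)"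
    \<comment> \<open>The order is written \<open>3 * n + n\<close> to match the shape in
      \<open>block_mat_4x4_carrier\<close>.\<close>
    by (rule pencil_equiv[of _ "3 * n + n"], unfold linearization_A_def linearization_B_def,
        simp_all only: diag_block_mat_4[of _ n] one_carrier_mat Qc Qa)
      (rule block_mat_4x4_carrier; use c Qc Qa in simp)+
  also have "\<dots> = four_block_mat (pencil ?M ?N) (pencil UA UB)
      (0\<^sub>m (n - k) (3 * n + k)) (pencil (0\<^sub>m (n - k) (n - k)) (- 1\<^sub>m (n - k)))"
    unfolding sA sB
    by (subst pencil_four_block[OF M _ _ _ N, of _ "n - k" _ "n - k"])
      (auto simp: UA_def UB_def pencil_zero)
  finally have eq: "const_mat ?S * pencil (linearization_A n B D E) (linearization_B n A C) * const_mat ?T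
    = four_block_mat (pencil ?M ?N) (pencil UA UB)
      (0\<^sub>m (n - k) (3 * n + k)) (pencil (0\<^sub>m (n - k) (n - k)) (- 1\<^sub>m (n - k)))" .
  have U: "pencil UA UB \<in> carrier_mat (3 * n + k) (n - k)"
    by (auto simp: UA_def UB_def pencil_def const_mat_def)
  show ?thesis
    unfolding exact_reduced_linearization_def using k M N Q U eq by blast
qed

section \<open>Pivoting structure and truncation error\<close>

text \<open>\<open>R $$ (j, j)\<close> is one entry of the column segment whose norm the pivoting
  condition bounds by the modulus of \<open>R $$ (i, i)\<close>.\<close>

lemma pivoting_diag_antimono:
  fixes R :: "complex mat"
  assumes "\<And>j i. j < n \<Longrightarrow> i \<le> j \<Longrightarrow> sqrt (\<Sum>l=i..j. (cmod (R $$ (l,j)))\<^sup>2) \<le> cmod (R $$ (i,i))"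
    and "i \<le> j" "j < n"
  shows "cmod (R $$ (j, j)) \<le> cmod (R $$ (i, i))"
proof -
  have "cmod (R $$ (j, j)) \<le> L2_set (\<lambda>l. cmod (R $$ (l, j))) {i..j}"
    using assms(2) by (intro member_le_L2_set) auto
  also have "\<dots> \<le> cmod (R $$ (i, i))" using assms unfolding L2_set_def by blast
  finally show ?thesis .
qed

text \<open>Pivoting at position \<open>k\<close> bounds the discarded column part by the first
  rejected diagonal entry, and the drop-off compares that entry with the last accepted one, at
  \<open>k - 1\<close>. Diagonal monotonicity leads on to any \<open>i < k\<close>. Prescribing only
  moduli for \<open>W\<close> leaves its sign free.\<close>

lemma truncation_error_col_le:
  fixes R :: "complex mat"
  assumes R: "R \<in> carrier_mat n n" "upper_triangular R"
    and piv: "\<And>j i. j < n \<Longrightarrow> i \<le> j \<Longrightarrow> sqrt (\<Sum>l=i..j. (cmod (R $$ (l,j)))\<^sup>2) \<le> cmod (R $$ (i,i))"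
    and drop: "k < n \<Longrightarrow> cmod (R $$ (k,k)) \<le> \<tau> * cmod (R $$ (k - 1, k - 1))"
    and ij: "i < k" "k \<le> j" "j < n" and \<tau>: "0 \<le> \<tau>"
    and W: "W \<in> carrier_mat n n" "\<And>l. l < n \<Longrightarrow> cmod (W $$ (l, j)) = (if l < k then 0 else cmod (R $$ (l, j)))"
  shows "vec_norm2 (col W j) \<le> \<tau> * vec_norm2 (col R i)"
proof -
  \<comment> \<open>Rows below \<open>k\<close> in index are zero in \<open>W\<close>; rows beyond
    \<open>j\<close> are zero because \<open>R\<close> is upper triangular.\<close>
  have "(\<Sum>l<n. (cmod (W $$ (l, j)))\<^sup>2) = (\<Sum>l=k..j. (cmod (R $$ (l, j)))\<^sup>2)"
    using R ij W(2) by (intro sum.mono_neutral_cong_right) (auto simp: not_less)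
  then have "vec_norm2 (col W j) = sqrt (\<Sum>l=k..j. (cmod (R $$ (l, j)))\<^sup>2)"
    using W(1) ij by (simp add: vec_norm2_def)
  also have "\<dots> \<le> cmod (R $$ (k, k))" using piv ij by simp
  also have "\<dots> \<le> \<tau> * cmod (R $$ (k - 1, k - 1))" using drop ij by simp
  also have "\<dots> \<le> \<tau> * cmod (R $$ (i, i))"
    using \<tau> ij by (intro mult_left_mono pivoting_diag_antimono[of n, OF piv]) auto
  also have "cmod (R $$ (i, i)) \<le> vec_norm2 (col R i)"
    using R ij member_le_L2_set[of "{..<n}" i "\<lambda>l. cmod (R $$ (l, i))"]
    by (simp add: vec_norm2_L2_set cong: L2_set_cong_simp)
  finally show ?thesis using \<tau> by (simp add: mult_left_mono)
qed

section \<open>The structured backward error bound\<close>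

text \<open>"Moderate function of n" is expressed by quantifier order: \<open>p_C\<close> and
  \<open>p_D\<close> are chosen from \<open>p_qr\<close>, \<open>c\<close> and \<open>\<eta>\<close>
  alone, before the dimension, the precision and the data. The smallness of n times the machine
  precision is the bound by \<open>\<eta>\<close>.\<close>

theorem proposition1:
  fixes p_qr :: "real poly" and c \<eta> :: real
  assumes "0 \<le> c" and "0 < \<eta>"
  shows "\<exists>p_C p_D :: real poly.
    degree p_C \<le> max 2 (degree p_qr) \<and> degree p_D \<le> max 2 (degree p_qr) \<and>
    (\<forall>(n::nat) (k::nat) (u::real) (\<tau>::real) (\<epsilon>\<^sub>q\<^sub>r::real)
       (A::complex mat) B C D E Qt P R X Y.
      0 < u \<longrightarrow> real n * u \<le> \<eta> \<longrightarrow> 0 \<le> \<tau> \<longrightarrow>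
      0 \<le> \<epsilon>\<^sub>q\<^sub>r \<longrightarrow> \<epsilon>\<^sub>q\<^sub>r \<le> poly p_qr (real n) * u \<longrightarrow>
      A \<in> carrier_mat n n \<longrightarrow> B \<in> carrier_mat n n \<longrightarrow> C \<in> carrier_mat n n \<longrightarrow>
      D \<in> carrier_mat n n \<longrightarrow> E \<in> carrier_mat n n \<longrightarrow>
      computed_rrqr n \<epsilon>\<^sub>q\<^sub>r \<tau> E Qt P R k \<longrightarrow>
      computed_adjoint_product n c u Qt D X \<longrightarrow>
      computed_adjoint_product n c u Qt C Y \<longrightarrow>
      (\<exists>dQ dC dD dE DE \<epsilon>\<^sub>C \<epsilon>\<^sub>D.
         dQ \<in> carrier_mat n n \<and> dC \<in> carrier_mat n n \<and> dD \<in> carrier_mat n n \<and>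
         dE \<in> carrier_mat n n \<and> DE \<in> carrier_mat n n \<and>
         frobenius_norm dQ \<le> \<epsilon>\<^sub>q\<^sub>r \<and>
         exact_reduced_linearization n k
           (reduced_A n k B X (truncated_R k R) P)
           (reduced_B n k A Y Qt + structured_dB n k dQ)
           A B (C + dC) (D + dD) (E + dE + DE) \<and>
         zero_eigenvalues_at_least (n - k) (quartic A B (C + dC) (D + dD) (E + dE + DE)) \<and>
         (\<forall>i<n. vec_norm2 (col dC i) \<le> \<epsilon>\<^sub>C * vec_norm2 (col C i) \<and>
                vec_norm2 (col dD i) \<le> \<epsilon>\<^sub>D * vec_norm2 (col D i) \<and>
                vec_norm2 (col dE i) \<le> \<epsilon>\<^sub>q\<^sub>r * vec_norm2 (col E i)) \<and>
         max_or_zero ((\<lambda>j. vec_norm2 (col (DE * P) (k + j))) ` {..<n - k})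
           \<le> \<tau> * Min ((\<lambda>i. vec_norm2 (col ((E + dE) * P) i)) ` {..<k}) \<and>
         (\<forall>i<k. col (DE * P) i = 0\<^sub>v n) \<and>
         0 \<le> \<epsilon>\<^sub>C \<and> \<epsilon>\<^sub>C \<le> poly p_C (real n) * u \<and>
         0 \<le> \<epsilon>\<^sub>D \<and> \<epsilon>\<^sub>D \<le> poly p_D (real n) * u))"
proof -
  \<comment> \<open>The three summands bound the three terms of \<open>\<epsilon>\<close> defined
    below, each divided by \<open>u\<close>: the QR error, the rounding error with
    \<open>sqrt (real n)\<close> replaced by \<open>real n\<close>, and the mixed term with
    \<open>real n * u\<close> replaced by \<open>\<eta>\<close>.\<close>
  define p where "p = p_qr + monom c 2 + smult (c * \<eta>) p_qr"
  have deg: "degree p \<le> max 2 (degree p_qr)"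
    unfolding p_def
    by (intro degree_add_le) (auto intro: order_trans[OF degree_monom_le] order_trans[OF degree_smult_le])
  show ?thesis
  proof (intro exI[of _ p] conjI deg allI impI)
    fix n k :: nat and u \<tau> \<epsilon>\<^sub>q\<^sub>r :: real and A B C D E Qt P R X Y :: "complex mat"
    assume u: "0 < u" and nu: "real n * u \<le> \<eta>" and \<tau>: "0 \<le> \<tau>"
      and e0: "0 \<le> \<epsilon>\<^sub>q\<^sub>r" and e: "\<epsilon>\<^sub>q\<^sub>r \<le> poly p_qr (real n) * u"
      and A: "A \<in> carrier_mat n n" and B: "B \<in> carrier_mat n n" and C: "C \<in> carrier_mat n n"
      and D: "D \<in> carrier_mat n n" and E: "E \<in> carrier_mat n n"
      and qr: "computed_rrqr n \<epsilon>\<^sub>q\<^sub>r \<tau> E Qt P R k"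
      and X: "computed_adjoint_product n c u Qt D X"
      and Y: "computed_adjoint_product n c u Qt C Y"
    obtain Q dE where Q: "unitary_mat n Q" and dE: "dE \<in> carrier_mat n n"
      and QR: "(E + dE) * P = Q * R"
      and dE_le: "\<forall>i<n. vec_norm2 (col dE i) \<le> \<epsilon>\<^sub>q\<^sub>r * vec_norm2 (col E i)"
      and Qt_Q: "frobenius_norm (Qt - Q) \<le> \<epsilon>\<^sub>q\<^sub>r"
      using qr unfolding computed_rrqr_def by auto
    have Qt: "Qt \<in> carrier_mat n n" and perm: "permutation_mat n P"
      and R: "R \<in> carrier_mat n n" "upper_triangular R"
      and piv: "\<And>j i. j < n \<Longrightarrow> i \<le> j \<Longrightarrow> sqrt (\<Sum>l=i..j. (cmod (R $$ (l,j)))\<^sup>2) \<le> cmod (R $$ (i,i))"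
      and k: "1 \<le> k" "k \<le> n"
      and drop: "k < n \<Longrightarrow> cmod (R $$ (k,k)) \<le> \<tau> * cmod (R $$ (k - 1, k - 1))"
      using qr unfolding computed_rrqr_def by auto
    note P = permutation_mat_transpose_mult[OF perm]
    have Qc: "Q \<in> carrier_mat n n" using Q by (simp add: unitary_mat_def)
    have Xc: "X \<in> carrier_mat n n" and Yc: "Y \<in> carrier_mat n n"
      using X Y unfolding computed_adjoint_product_def by auto

    define dQ where "dQ = Q - Qt"
    define dC where "dC = Q * Y - C"
    define dD where "dD = Q * X - D"
    \<comment> \<open>\<open>T\<close> is the truncated factor padded with zero rows to order
      \<open>n\<close>, and \<open>S\<close> restores the original column order. Thus
      \<open>Q * S\<close> is what replaces \<open>E + dE\<close>.\<close>
    define T where "T = mat n n (\<lambda>(i, j). if i < k then R $$ (i, j) else 0)"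
    define S where "S = T * transpose_mat P"
    define DE where "DE = Q * S - (E + dE)"
    define \<epsilon> where "\<epsilon> = \<epsilon>\<^sub>q\<^sub>r + c * real n * u * (sqrt (real n) + \<epsilon>\<^sub>q\<^sub>r)"
    have T: "T \<in> carrier_mat n n" by (simp add: T_def)
    have S: "S \<in> carrier_mat n n" using T P(1) by (simp add: S_def)
    have carr: "dQ \<in> carrier_mat n n" "dC \<in> carrier_mat n n" "dD \<in> carrier_mat n n"
      "DE \<in> carrier_mat n n"
      using Qc Qt Xc Yc C D E dE S by (auto simp: dQ_def dC_def dD_def DE_def)

    \<comment> \<open>Hence the adjoint of \<open>Q\<close> maps the perturbed coefficients exactly
      to the computed blocks \<open>Y\<close> and \<open>X\<close>.\<close>
    have C': "C + dC = Q * Y" and D': "D + dD = Q * X"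
      by (rule eq_matI; use Qc C D Xc Yc in \<open>auto simp: dC_def dD_def\<close>)+
    have E': "E + dE + DE = Q * S"
      by (rule eq_matI) (use Qc S E dE in \<open>auto simp: DE_def\<close>)
    have Q_inv: "mat_adjoint Q * (Q * M) = M" if "M \<in> carrier_mat n n" for M
      using unitary_cancel_left(1)[OF Q that] .

    have bottom: "S $$ (i, j) = 0" if "k \<le> i" "i < n" "j < n" for i j
      using that T P(1) by (simp add: S_def scalar_prod_def) (simp add: T_def)
    have top: "S $$ (i, j) = (truncated_R k R * transpose_mat P) $$ (i, j)" if "i < k" "j < n" for i j
      using that k P(1) R(1) by (simp add: S_def T_def truncated_R_def scalar_prod_def)
    have "exact_reduced_linearization n k
        (reduced_A n k B (mat_adjoint Q * (D + dD)) (truncated_R k R) P)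
        (reduced_B n k A (mat_adjoint Q * (C + dC)) Qt + structured_dB n k (Q - Qt))
        A B (C + dC) (D + dD) (E + dE + DE)"
      by (rule exact_reduced_linearizationI[OF Q k(2)])
        (use A B C D E dE carr Qc S Qt P(1) R(1) top bottom in \<open>simp_all add: E' Q_inv[OF S] truncated_R_def\<close>)
    then have lin: "exact_reduced_linearization n k
        (reduced_A n k B X (truncated_R k R) P) (reduced_B n k A Y Qt + structured_dB n k dQ)
        A B (C + dC) (D + dD) (E + dE + DE)"
      unfolding C' D' by (simp add: Q_inv Xc Yc dQ_def)
    have zero: "zero_eigenvalues_at_least (n - k) (quartic A B (C + dC) (D + dD) (E + dE + DE))"
      by (rule zero_eigenvalues_quartic[OF Q])
        (use A B C D E dE carr Qc S bottom in \<open>simp_all add: E' Q_inv[OF S]\<close>)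

    have dQ_le: "frobenius_norm dQ \<le> \<epsilon>\<^sub>q\<^sub>r"
    proof -
      have "frobenius_norm dQ = frobenius_norm (Qt - Q)"
        using Qc Qt by (simp add: frobenius_norm_def dQ_def norm_minus_commute)
      then show ?thesis using Qt_Q by simp
    qed
    have cu: "0 \<le> c * real n * u" using assms(1) u by simp
    have col_le: "vec_norm2 (col dC i) \<le> \<epsilon> * vec_norm2 (col C i)"
      "vec_norm2 (col dD i) \<le> \<epsilon> * vec_norm2 (col D i)" if "i < n" for i
      unfolding dC_def dD_def \<epsilon>_def
      by (rule computed_product_backward_error[OF Q Qt _ Qt_Q cu]; use C D X Y that in simp)+
    have \<epsilon>0: "0 \<le> \<epsilon>" using e0 cu by (simp add: \<epsilon>_def)
    have \<epsilon>_le: "\<epsilon> \<le> poly p (real n) * u"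
    proof -
      have "real n \<ge> 1" using k by simp
      then have "sqrt (real n) \<le> real n"
        using real_sqrt_le_mono[of "real n" "(real n)\<^sup>2"] by (simp add: power2_eq_square)
      then have 1: "c * real n * u * sqrt (real n) \<le> c * real n * u * real n"
        using cu by (rule mult_left_mono)
      \<comment> \<open>In the term of second order in \<open>u\<close>, one factor is absorbed by
        \<open>real n * u \<le> \<eta>\<close>.\<close>
      have "c * (real n * u) * \<epsilon>\<^sub>q\<^sub>r \<le> c * \<eta> * \<epsilon>\<^sub>q\<^sub>r"
        using assms nu e0 by (intro mult_right_mono mult_left_mono) auto
      also have "\<dots> \<le> c * \<eta> * (poly p_qr (real n) * u)"
        using assms e by (intro mult_left_mono) auto
      finally have 2: "c * (real n * u) * \<epsilon>\<^sub>q\<^sub>r \<le> c * \<eta> * (poly p_qr (real n) * u)" .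
      show ?thesis using e 1 2
        by (simp add: \<epsilon>_def p_def poly_monom algebra_simps power2_eq_square)
    qed

    have SP: "S * P = T"
    proof -
      have "S * P = T * (transpose_mat P * P)"
        unfolding S_def using T P(1) by (intro assoc_mult_mat) auto
      then show ?thesis using P(2) T by simp
    qed
    \<comment> \<open>In pivoted columns the truncation error is the unitary image of minus the
      discarded part of \<open>R\<close>, so its column norms can be computed from \<open>R\<close>
      alone.\<close>
    have DEP: "DE * P = Q * (T - R)"
    proof -
      have "DE * P = Q * S * P - (E + dE) * P"
        unfolding DE_def using Qc S E dE P(1) by (intro minus_mult_distrib_mat) auto
      also have "Q * S * P = Q * T"
        using Qc S P(1) SP assoc_mult_mat[of Q n n S n P n] by simp
      also have "Q * T - (E + dE) * P = Q * (T - R)"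
        unfolding QR using Qc T R(1) by (intro mult_minus_distrib_mat[symmetric]) auto
      finally show ?thesis .
    qed
    have TR: "T - R \<in> carrier_mat n n" using R(1) by (rule minus_carrier_mat)
    have col0: "col (DE * P) i = 0\<^sub>v n" if "i < k" for i
    proof -
      \<comment> \<open>In columns before \<open>k\<close>, the rows kept agree with
        \<open>R\<close>, and the rows dropped lie below the diagonal and are already zero.\<close>
      have "col (T - R) i = 0\<^sub>v n"
        by (rule eq_vecI) (use that k T R in \<open>auto simp: T_def not_less\<close>)
      then show ?thesis
        unfolding DEP using col_mult2[OF Qc TR, of i] that k Qc by auto
    qed
    have trunc: "vec_norm2 (col (DE * P) (k + j)) \<le> \<tau> * vec_norm2 (col ((E + dE) * P) i)"
      if "i < k" "j < n - k" for i j
    proof -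
      have "vec_norm2 (col (T - R) (k + j)) \<le> \<tau> * vec_norm2 (col R i)"
        by (rule truncation_error_col_le[OF R piv drop]) (use that \<tau> T R(1) in \<open>auto simp: T_def\<close>)
      then show ?thesis
        using that k vec_norm2_col_unitary[OF Q TR, of "k + j"] vec_norm2_col_unitary[OF Q R(1), of i]
        by (simp add: DEP QR)
    qed
    let ?E = "(\<lambda>i. vec_norm2 (col ((E + dE) * P) i)) ` {..<k}"
    \<comment> \<open>\<open>1 \<le> k\<close> makes the set nonempty, so the minimum is attained
      and the column bound can be used at the minimizing index.\<close>
    have "Min ?E \<in> ?E" using k by (intro Min_in) (auto simp: lessThan_empty_iff)
    then obtain i where i: "i < k" "Min ?E = vec_norm2 (col ((E + dE) * P) i)" by auto
    \<comment> \<open>For \<open>k = n\<close> the maximum is 0 by convention, and the right-hand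
      side is nonnegative since \<open>0 \<le> \<tau>\<close>.\<close>
    have max_le: "max_or_zero ((\<lambda>j. vec_norm2 (col (DE * P) (k + j))) ` {..<n - k}) \<le> \<tau> * Min ?E"
      unfolding i(2) max_or_zero_def using trunc[OF i(1)] \<tau> by (auto intro!: Max.boundedI)

    show "\<exists>dQ dC dD dE DE \<epsilon>\<^sub>C \<epsilon>\<^sub>D.
         dQ \<in> carrier_mat n n \<and> dC \<in> carrier_mat n n \<and> dD \<in> carrier_mat n n \<and>
         dE \<in> carrier_mat n n \<and> DE \<in> carrier_mat n n \<and>
         frobenius_norm dQ \<le> \<epsilon>\<^sub>q\<^sub>r \<and>
         exact_reduced_linearization n k
           (reduced_A n k B X (truncated_R k R) P)
           (reduced_B n k A Y Qt + structured_dB n k dQ)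
           A B (C + dC) (D + dD) (E + dE + DE) \<and>
         zero_eigenvalues_at_least (n - k) (quartic A B (C + dC) (D + dD) (E + dE + DE)) \<and>
         (\<forall>i<n. vec_norm2 (col dC i) \<le> \<epsilon>\<^sub>C * vec_norm2 (col C i) \<and>
                vec_norm2 (col dD i) \<le> \<epsilon>\<^sub>D * vec_norm2 (col D i) \<and>
                vec_norm2 (col dE i) \<le> \<epsilon>\<^sub>q\<^sub>r * vec_norm2 (col E i)) \<and>
         max_or_zero ((\<lambda>j. vec_norm2 (col (DE * P) (k + j))) ` {..<n - k})
           \<le> \<tau> * Min ((\<lambda>i. vec_norm2 (col ((E + dE) * P) i)) ` {..<k}) \<and>
         (\<forall>i<k. col (DE * P) i = 0\<^sub>v n) \<and>
         0 \<le> \<epsilon>\<^sub>C \<and> \<epsilon>\<^sub>C \<le> poly p (real n) * u \<and>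
         0 \<le> \<epsilon>\<^sub>D \<and> \<epsilon>\<^sub>D \<le> poly p (real n) * u"
      \<comment> \<open>One value \<open>\<epsilon>\<close> serves for both
        \<open>\<epsilon>\<^sub>C\<close> and \<open>\<epsilon>\<^sub>D\<close>, as \<open>C\<close>
        and \<open>D\<close> undergo the same computed product.\<close>
      by (rule exI[of _ dQ], rule exI[of _ dC], rule exI[of _ dD], rule exI[of _ dE],
          rule exI[of _ DE], rule exI[of _ \<epsilon>], rule exI[of _ \<epsilon>])
        (use carr dE dQ_le lin zero col_le dE_le max_le col0 \<epsilon>0 \<epsilon>_le in simp)
  qed
qed

end
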